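(* Let $X$ be an Archimedean vector lattice with order completion $X^\delta$, and let $(T_s)_{s\ge 0}$ be a semigroup on $X$ such that every $T_s:X\to X$ is an order continuous operator. Then $(T_s)_{s\ge 0}$ possesses a unique extension to a semigroup $(T_s^\delta)_{s\ge 0}$ of order continuous operators on $X^\delta$; that is, there exists exactly one semigroup $(T_s^\delta)_{s\ge 0}$ on $X^\delta$ such that each $T_s^\delta:X^\delta\to X^\delta$ is order continuous and $T_s^\delta x=T_sx$ for all $x\in X$ and $s\ge 0$.
   Context: All vector spaces are real and all operators are linear. A semigroup on a vector space $V$ is a family $(T_s)_{s\ge 0}$ of linear operators $V\to V$ such that $T_{s+t}=T_sT_t$ for all $s,t\in\mathbb{R}_+$ and $T_0=I_V$ is the identity operator on $V$ (no continuity in $s$ is assumed). The order completion $X^\delta$ of an Archimedean vector lattice $X$ is its Dedekind completion: the (unique up to lattice isomorphism) Dedekind complete vector lattice containing $X$ as an order dense and majorizing vector sublattice; $X$ is regarded as a sublattice of $X^\delta$. A net $(x_\alpha)$ in a vector lattice order converges to $x$, written $x_\alpha\xrightarrow{o}x$, if there is a net $(y_\beta)$ with $y_\beta\downarrow 0$ such that for every $\beta$ there is $\alpha_\beta$ with $|x_\alpha-x|\le y_\beta$ for all $\alpha\ge\alpha_\beta$. A linear operator $T$ between vector lattices is order continuous if $x_\alpha\xrightarrow{o}0$ implies $Tx_\alpha\xrightarrow{o}0$ for every net $(x_\alpha)$. Order boundedness or regularity of the operators $T_s$ is not assumed. *)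

theory Defs
  imports Complex_Main "HOL-Library.Lattice_Algebras" "HOL-Library.FuncSet"
begin

text \<open>
  In the following classes the modulus is the lattice one: class
  \<^class>\<open>lattice_ab_group_add_abs\<close> contains the axiom \<open>\<bar>x\<bar> = sup x (- x)\<close>.
\<close>

class vector_lattice = ordered_real_vector + lattice_ab_group_add_abs

class archimedean_vector_lattice = vector_lattice +
  assumes archimedean: "(\<And>n::nat. real n *\<^sub>R x \<le> y) \<Longrightarrow> x \<le> 0"

class dedekind_complete_vector_lattice = vector_lattice + conditionally_complete_lattice

text \<open>
  The vector lattice \<open>'a\<close> is identified with its image under \<open>\<iota>\<close>, a vector
  sublattice of \<open>'b\<close>.
\<close>

definition order_completion ::
  "('a::archimedean_vector_lattice \<Rightarrow> 'b::dedekind_complete_vector_lattice) \<Rightarrow> bool" where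
  "order_completion \<iota> \<longleftrightarrow>
     linear \<iota> \<and> inj \<iota> \<and>
     (\<forall>x y. \<iota> (sup x y) = sup (\<iota> x) (\<iota> y)) \<and>
     (\<forall>x y. \<iota> (inf x y) = inf (\<iota> x) (\<iota> y)) \<and>
     (\<forall>y>0. \<exists>x>0. \<iota> x \<le> y) \<and>
     (\<forall>y. \<exists>x. y \<le> \<iota> x)"

text \<open>
  A net is a function on a directed index set \<open>(A, le)\<close>, where \<open>le i j\<close> means
  that \<open>j\<close> is beyond \<open>i\<close>.
\<close>

definition directed_set :: "'i set \<Rightarrow> ('i \<Rightarrow> 'i \<Rightarrow> bool) \<Rightarrow> bool" where
  "directed_set A le \<longleftrightarrow>
     A \<noteq> {} \<and> reflp_on A le \<and> transp_on A le \<and> (\<forall>i\<in>A. \<forall>j\<in>A. \<exists>k\<in>A. le i k \<and> le j k)"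

definition decreases_to_zero ::
  "'j set \<Rightarrow> ('j \<Rightarrow> 'j \<Rightarrow> bool) \<Rightarrow> ('j \<Rightarrow> 'a::vector_lattice) \<Rightarrow> bool" where
  "decreases_to_zero B le y \<longleftrightarrow>
     directed_set B le \<and>
     (\<forall>i\<in>B. \<forall>j\<in>B. le i j \<longrightarrow> y j \<le> y i) \<and>
     (\<forall>j\<in>B. 0 \<le> y j) \<and>
     (\<forall>z. (\<forall>j\<in>B. z \<le> y j) \<longrightarrow> z \<le> 0)"

definition dominates_tails ::
  "'j set \<Rightarrow> ('j \<Rightarrow> 'a) \<Rightarrow> 'i set \<Rightarrow> ('i \<Rightarrow> 'i \<Rightarrow> bool) \<Rightarrow> ('i \<Rightarrow> 'a) \<Rightarrow> 'a::vector_lattice \<Rightarrow> bool" where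
  "dominates_tails B y A le x l \<longleftrightarrow>
     (\<forall>\<beta>\<in>B. \<exists>\<alpha>0\<in>A. \<forall>\<alpha>\<in>A. le \<alpha>0 \<alpha> \<longrightarrow> \<bar>x \<alpha> - l\<bar> \<le> y \<beta>)"

text \<open>
  A definition cannot quantify over index types, so the dominating net below is indexed
  by a subset of \<open>'a\<close>, and the nets in the definition of order continuity by a subset of
  \<open>'a \<times> 'a set\<close>. This is no restriction: the lemmas \<open>order_convergesI\<close> and
  \<open>order_continuousD\<close> give the same properties for arbitrary index types.
\<close>

definition order_converges ::
  "'i set \<Rightarrow> ('i \<Rightarrow> 'i \<Rightarrow> bool) \<Rightarrow> ('i \<Rightarrow> 'a) \<Rightarrow> 'a::vector_lattice \<Rightarrow> bool" where
  "order_converges A le x l \<longleftrightarrow>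
     (\<exists>(B :: 'a set) leB y. decreases_to_zero B leB y \<and> dominates_tails B y A le x l)"

definition order_continuous :: "('a::vector_lattice \<Rightarrow> 'b::vector_lattice) \<Rightarrow> bool" where
  "order_continuous T \<longleftrightarrow>
     (\<forall>(A :: ('a \<times> 'a set) set) le x.
        directed_set A le \<longrightarrow> order_converges A le x 0 \<longrightarrow> order_converges A le (\<lambda>\<alpha>. T (x \<alpha>)) 0)"

lemma order_convergesI:
  fixes B :: "'j set" and y :: "'j \<Rightarrow> 'a::vector_lattice"
  assumes y: "decreases_to_zero B leB y" and dom: "dominates_tails B y A le x l"
  shows "order_converges A le x l"
proof -
  have "\<exists>w\<in>y ` B. w \<le> u \<and> w \<le> v" if "u \<in> y ` B" "v \<in> y ` B" for u v
  proof -
    obtain i j where ij: "i \<in> B" "j \<in> B" "u = y i" "v = y j"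
      using \<open>u \<in> y ` B\<close> \<open>v \<in> y ` B\<close> unfolding image_iff by blast
    then obtain k where "k \<in> B" "leB i k" "leB j k"
      using y unfolding decreases_to_zero_def directed_set_def by blast
    then show ?thesis
      using y ij unfolding decreases_to_zero_def by blast
  qed
  moreover have "B \<noteq> {}" "\<forall>j\<in>B. 0 \<le> y j" "\<forall>z. (\<forall>j\<in>B. z \<le> y j) \<longrightarrow> z \<le> 0"
    using y by (simp_all add: decreases_to_zero_def directed_set_def)
  ultimately have "decreases_to_zero (y ` B) (\<ge>) (\<lambda>u. u)"
    unfolding decreases_to_zero_def directed_set_def
    by (simp add: reflp_on_def transp_on_def)
  moreover have "dominates_tails (y ` B) (\<lambda>u. u) A le x l"
    using dom unfolding dominates_tails_def by blast
  ultimately show ?thesis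
    unfolding order_converges_def by blast
qed

lemma order_continuousD:
  fixes T :: "'a::vector_lattice \<Rightarrow> 'b::vector_lattice" and A :: "'i set"
  assumes T: "order_continuous T" and A: "directed_set A le" and x: "order_converges A le x 0"
  shows "order_converges A le (\<lambda>\<alpha>. T (x \<alpha>)) 0"
proof -
  define tail where "tail i = x ` {j \<in> A. le i j}" for i
  define A' where "A' = (\<lambda>i. (x i, tail i)) ` A"
  define le' where "le' = (\<lambda>(p :: 'a \<times> 'a set) (q :: 'a \<times> 'a set). snd q \<subseteq> snd p)"
  have refl: "le i i" if "i \<in> A" for i
    using A that by (auto simp: directed_set_def reflp_on_def)
  have trans: "le i k" if "i \<in> A" "j \<in> A" "k \<in> A" "le i j" "le j k" for i j k
    using A that unfolding directed_set_def transp_on_def by blast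
  have tail_mono: "tail j \<subseteq> tail i" if "i \<in> A" "j \<in> A" "le i j" for i j
    using trans that unfolding tail_def by blast
  have tail_self: "x i \<in> tail i" if "i \<in> A" for i
    using refl that unfolding tail_def by blast
  have "\<exists>k\<in>A. tail k \<subseteq> tail i \<and> tail k \<subseteq> tail j" if "i \<in> A" "j \<in> A" for i j
  proof -
    obtain k where "k \<in> A" "le i k" "le j k"
      using A \<open>i \<in> A\<close> \<open>j \<in> A\<close> unfolding directed_set_def by blast
    then show ?thesis
      using tail_mono that by blast
  qed
  then have A': "directed_set A' le'"
    using A unfolding directed_set_def A'_def le'_def
    by (simp add: reflp_on_def transp_on_def subset_trans)
  obtain B :: "'a set" and leB y where y: "decreases_to_zero B leB y"
    and dom: "dominates_tails B y A le x 0"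
    using x unfolding order_converges_def by blast
  have "dominates_tails B y A' le' fst 0"
    unfolding dominates_tails_def
  proof
    fix \<beta> assume "\<beta> \<in> B"
    then obtain i where i: "i \<in> A" "\<forall>j\<in>A. le i j \<longrightarrow> \<bar>x j - 0\<bar> \<le> y \<beta>"
      using dom unfolding dominates_tails_def by blast
    then have "\<forall>u\<in>tail i. \<bar>u - 0\<bar> \<le> y \<beta>"
      unfolding tail_def by blast
    then have "\<forall>q\<in>A'. le' (x i, tail i) q \<longrightarrow> \<bar>fst q - 0\<bar> \<le> y \<beta>"
      using tail_self unfolding A'_def le'_def by (simp add: subset_iff)
    then show "\<exists>p\<in>A'. \<forall>q\<in>A'. le' p q \<longrightarrow> \<bar>fst q - 0\<bar> \<le> y \<beta>"
      using i(1) unfolding A'_def by blast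
  qed
  then have "order_converges A' le' (\<lambda>p. T (fst p)) 0"
    using T A' order_convergesI [OF y] unfolding order_continuous_def by blast
  then obtain C :: "'b set" and leC z where z: "decreases_to_zero C leC z"
    and domT: "dominates_tails C z A' le' (\<lambda>p. T (fst p)) 0"
    unfolding order_converges_def by blast
  have "dominates_tails C z A le (\<lambda>\<alpha>. T (x \<alpha>)) 0"
    unfolding dominates_tails_def
  proof
    fix \<gamma> assume "\<gamma> \<in> C"
    then obtain i where i: "i \<in> A"
      "\<forall>q\<in>A'. le' (x i, tail i) q \<longrightarrow> \<bar>T (fst q) - 0\<bar> \<le> z \<gamma>"
      using domT unfolding dominates_tails_def A'_def by blast
    then have "\<forall>j\<in>A. le i j \<longrightarrow> \<bar>T (x j) - 0\<bar> \<le> z \<gamma>"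
      using tail_mono unfolding A'_def le'_def by simp
    with i(1) show "\<exists>i\<in>A. \<forall>j\<in>A. le i j \<longrightarrow> \<bar>T (x j) - 0\<bar> \<le> z \<gamma>"
      by blast
  qed
  with z show ?thesis
    by (rule order_convergesI)
qed

text \<open>
  Only the members with index \<open>s \<ge> 0\<close> matter. Two semigroups are equal as families over
  \<open>{0..}\<close> iff their representatives in \<^term>\<open>extensional {0..}\<close> are equal.
\<close>

definition operator_semigroup :: "(real \<Rightarrow> 'a::real_vector \<Rightarrow> 'a) \<Rightarrow> bool" where
  "operator_semigroup T \<longleftrightarrow>
     (\<forall>s\<ge>0. linear (T s)) \<and>
     (\<forall>s\<ge>0. \<forall>t\<ge>0. T (s + t) = T s \<circ> T t) \<and>
     T 0 = id"

end

theory Submission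
  imports Defs
begin

text \<open>
  Order continuity is a uniform smallness condition in disguise. Given a downward directed set
  \<open>W\<close> with infimum \<open>0\<close>, take as one net all pairs \<open>(w, x)\<close> with \<open>\<bar>x\<bar> \<le> w \<in> W\<close>, ordered by \<open>w\<close>
  alone. Its values \<open>x\<close> order converge to \<open>0\<close>, so order continuity of \<open>T\<close> bounds \<open>T\<close> on entire
  order intervals \<open>[- w, w]\<close> at once (lemma \<open>order_continuous_iff\<close>).

  With this condition an order continuous linear operator \<open>R\<close> from \<open>X\<close> to a Dedekind complete space
  extends to \<open>X\<^sup>\<delta>\<close> in the way a uniformly continuous map extends from a dense subspace. An element
  \<open>y\<close> of \<open>X\<^sup>\<delta>\<close> is squeezed by brackets \<open>b \<le> y \<le> a\<close> with \<open>a, b \<in> X\<close>; since \<open>X\<close> is order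
  dense and majorizing, the widths \<open>a - b\<close> decrease to \<open>0\<close> (lemma \<open>null_base_bracket_widths\<close>).
  Hence \<open>R\<close> oscillates arbitrarily little on small brackets, and Dedekind completeness provides a
  limit (lemma \<open>bracket_limit_exists\<close>), which is the value of the extension at \<open>y\<close>. The Riesz
  decomposition property makes the limit additive, and the uniform bounds on \<open>[- w, w]\<close> pass to it,
  so the extension is again order continuous. Conversely, the values of any order continuous linear
  extension are limits of this kind (lemma \<open>bracket_limit_extension\<close>), so the extension is unique.

  Applied to \<open>T\<^sub>s\<close> followed by the embedding into \<open>X\<^sup>\<delta>\<close>, this gives \<open>T\<^sub>s\<^sup>\<delta>\<close>. The semigroup laws
  follow from uniqueness, because \<open>T\<^sub>s\<^sup>\<delta> \<circ> T\<^sub>t\<^sup>\<delta>\<close> and the identity are order continuous linear extensions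
  of \<open>T\<^sub>s \<circ> T\<^sub>t = T\<^sub>s\<^sub>+\<^sub>t\<close> and of the identity.
\<close>

section \<open>Order continuity as uniform smallness on order intervals\<close>

text \<open>
  The set of values of a net decreasing to zero; the index set carries no further information.
\<close>

definition null_base :: "'a::vector_lattice set \<Rightarrow> bool" where
  "null_base W \<longleftrightarrow>
     W \<noteq> {} \<and> (\<forall>u\<in>W. \<forall>v\<in>W. \<exists>w\<in>W. w \<le> u \<and> w \<le> v) \<and>
     (\<forall>w\<in>W. 0 \<le> w) \<and> (\<forall>z. (\<forall>w\<in>W. z \<le> w) \<longrightarrow> z \<le> 0)"

lemma null_baseI:
  assumes "W \<noteq> {}" "\<And>u v. u \<in> W \<Longrightarrow> v \<in> W \<Longrightarrow> \<exists>w\<in>W. w \<le> u \<and> w \<le> v"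
    "\<And>w. w \<in> W \<Longrightarrow> 0 \<le> w" "\<And>z. (\<And>w. w \<in> W \<Longrightarrow> z \<le> w) \<Longrightarrow> z \<le> 0"
  shows "null_base W"
  using assms unfolding null_base_def by blast

lemma null_base_ne: "null_base W \<Longrightarrow> W \<noteq> {}"
  and null_base_directed:
    "null_base W \<Longrightarrow> u \<in> W \<Longrightarrow> v \<in> W \<Longrightarrow> \<exists>w\<in>W. w \<le> u \<and> w \<le> v"
  and null_base_nonneg: "null_base W \<Longrightarrow> w \<in> W \<Longrightarrow> 0 \<le> w"
  and null_base_le_0: "null_base W \<Longrightarrow> (\<And>w. w \<in> W \<Longrightarrow> z \<le> w) \<Longrightarrow> z \<le> 0"
  unfolding null_base_def by blast+

lemma null_base_singleton_0: "null_base {0}"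
  by (rule null_baseI) auto

lemma null_base_add_le:
  assumes V: "null_base V" and le: "\<And>v. v \<in> V \<Longrightarrow> z \<le> u + v"
  shows "z \<le> u"
proof -
  have "z - u \<le> 0"
    using V by (rule null_base_le_0) (use le in \<open>simp add: algebra_simps\<close>)
  then show ?thesis by simp
qed

lemma null_base_plus:
  assumes V: "null_base V" and W: "null_base W"
  shows "null_base {v + w | v w. v \<in> V \<and> w \<in> W}"
proof (rule null_baseI)
  show "{v + w | v w. v \<in> V \<and> w \<in> W} \<noteq> {}"
    using null_base_ne[OF V] null_base_ne[OF W] by blast
next
  fix p q
  assume "p \<in> {v + w | v w. v \<in> V \<and> w \<in> W}" "q \<in> {v + w | v w. v \<in> V \<and> w \<in> W}"
  then obtain v w v' w' where "p = v + w" "q = v' + w'" "v \<in> V" "v' \<in> V" "w \<in> W" "w' \<in> W"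
    by blast
  moreover obtain v'' where "v'' \<in> V" "v'' \<le> v" "v'' \<le> v'"
    using null_base_directed[OF V \<open>v \<in> V\<close> \<open>v' \<in> V\<close>] by blast
  moreover obtain w'' where "w'' \<in> W" "w'' \<le> w" "w'' \<le> w'"
    using null_base_directed[OF W \<open>w \<in> W\<close> \<open>w' \<in> W\<close>] by blast
  ultimately show "\<exists>r\<in>{v + w | v w. v \<in> V \<and> w \<in> W}. r \<le> p \<and> r \<le> q"
    by (intro bexI[of _ "v'' + w''"]) (auto intro: add_mono)
next
  fix p assume "p \<in> {v + w | v w. v \<in> V \<and> w \<in> W}"
  then show "0 \<le> p"
    using null_base_nonneg[OF V] null_base_nonneg[OF W] by (auto intro: add_nonneg_nonneg)
next
  fix z assume z: "\<And>p. p \<in> {v + w | v w. v \<in> V \<and> w \<in> W} \<Longrightarrow> z \<le> p"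
  have "z \<le> 0 + v" if "v \<in> V" for v
    using W by (rule null_base_add_le) (use z that in auto)
  then show "z \<le> 0"
    by (rule null_base_add_le[OF V])
qed

lemma null_base_scaleR:
  assumes V: "null_base V" and c: "0 < c"
  shows "null_base ((*\<^sub>R) c ` V)"
proof (rule null_baseI)
  show "(*\<^sub>R) c ` V \<noteq> {}"
    using null_base_ne[OF V] by simp
next
  fix p q assume "p \<in> (*\<^sub>R) c ` V" "q \<in> (*\<^sub>R) c ` V"
  then obtain u v where uv: "u \<in> V" "v \<in> V" "p = c *\<^sub>R u" "q = c *\<^sub>R v" by blast
  then obtain w where "w \<in> V" "w \<le> u" "w \<le> v"
    using null_base_directed[OF V] by blast
  then show "\<exists>r\<in>(*\<^sub>R) c ` V. r \<le> p \<and> r \<le> q"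
    using uv c by (auto intro!: scaleR_left_mono)
next
  fix p assume "p \<in> (*\<^sub>R) c ` V"
  then show "0 \<le> p"
    using null_base_nonneg[OF V] c by (auto intro: scaleR_nonneg_nonneg)
next
  fix z assume z: "\<And>p. p \<in> (*\<^sub>R) c ` V \<Longrightarrow> z \<le> p"
  have "inverse c *\<^sub>R z \<le> v" if "v \<in> V" for v
    using scaleR_left_mono[OF z[of "c *\<^sub>R v"], of "inverse c"] that c by simp
  then have "inverse c *\<^sub>R z \<le> 0"
    by (rule null_base_le_0[OF V])
  from scaleR_left_mono[OF this, of c] c show "z \<le> 0" by simp
qed

lemma abs_scaleR_pos:
  fixes u :: "'a::vector_lattice"
  assumes "0 < c"
  shows "\<bar>c *\<^sub>R u\<bar> \<le> c *\<^sub>R \<bar>u\<bar>"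
  using assms
  by (intro abs_leI)
    (auto simp flip: scaleR_minus_right intro!: scaleR_left_mono abs_ge_self abs_ge_minus_self)

lemma null_base_image:
  assumes "decreases_to_zero B le y"
  shows "null_base (y ` B)"
proof (rule null_baseI)
  show "y ` B \<noteq> {}" "\<And>w. w \<in> y ` B \<Longrightarrow> 0 \<le> w"
    "\<And>z. (\<And>w. w \<in> y ` B \<Longrightarrow> z \<le> w) \<Longrightarrow> z \<le> 0"
    using assms unfolding decreases_to_zero_def directed_set_def by auto
next
  fix u v assume "u \<in> y ` B" "v \<in> y ` B"
  then obtain i j where ij: "i \<in> B" "j \<in> B" "u = y i" "v = y j" by blast
  then obtain k where "k \<in> B" "le i k" "le j k"
    using assms unfolding decreases_to_zero_def directed_set_def by blast
  then show "\<exists>w\<in>y ` B. w \<le> u \<and> w \<le> v"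
    using assms ij unfolding decreases_to_zero_def by blast
qed

lemma null_base_decreases_to_zero:
  assumes "null_base W"
  shows "decreases_to_zero W (\<ge>) (\<lambda>w. w)"
  using assms unfolding null_base_def decreases_to_zero_def directed_set_def
  by (auto simp: reflp_on_def transp_on_def)

text \<open>
  For the direction from left to right a single net suffices: index it by the pairs \<open>(w, x)\<close> with
  \<open>\<bar>x\<bar> \<le> w\<close> and let the preorder ignore \<open>x\<close>. A tail of that net contains an entire interval
  \<open>[- w, w]\<close>. For linear \<open>T\<close> on an Archimedean space and \<open>W = {c /\<^sub>R n | n > 0}\<close> with \<open>c \<ge> 0\<close> this contains the fact
  that order continuous operators are order bounded.
\<close>

lemma order_continuous_iff:
  fixes T :: "'a::vector_lattice \<Rightarrow> 'b::vector_lattice"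
  shows "order_continuous T \<longleftrightarrow>
    (\<forall>W. null_base W \<longrightarrow>
      (\<exists>V. null_base V \<and> (\<forall>v\<in>V. \<exists>w\<in>W. \<forall>x. \<bar>x\<bar> \<le> w \<longrightarrow> \<bar>T x\<bar> \<le> v)))" (is "_ \<longleftrightarrow> ?R")
proof
  assume T: "order_continuous T"
  show ?R
  proof (intro allI impI)
    fix W :: "'a set" assume W: "null_base W"
    define A where "A = {(w, x). w \<in> W \<and> \<bar>x\<bar> \<le> w}"
    define le where "le = (\<lambda>(p :: 'a \<times> 'a) (q :: 'a \<times> 'a). fst q \<le> fst p)"
    have center: "(w, 0) \<in> A" if "w \<in> W" for w
      using that null_base_nonneg[OF W] unfolding A_def by simp
    have "\<exists>k\<in>A. le i k \<and> le j k" if "i \<in> A" "j \<in> A" for i j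
    proof -
      have "fst i \<in> W" "fst j \<in> W" using that unfolding A_def by auto
      then obtain w where "w \<in> W" "w \<le> fst i" "w \<le> fst j"
        using null_base_directed[OF W] by blast
      then show ?thesis
        using center unfolding le_def by (metis fst_conv)
    qed
    then have A: "directed_set A le"
      using null_base_ne[OF W] center unfolding directed_set_def
      by (auto simp: reflp_on_def transp_on_def le_def)
    have "dominates_tails W (\<lambda>w. w) A le snd 0"
      unfolding dominates_tails_def
    proof
      fix w assume "w \<in> W"
      then show "\<exists>p\<in>A. \<forall>q\<in>A. le p q \<longrightarrow> \<bar>snd q - 0\<bar> \<le> w"
        by (intro bexI[OF _ center]) (auto simp: A_def le_def)
    qed
    then have "order_converges A le snd 0"
      by (rule order_convergesI[OF null_base_decreases_to_zero[OF W]])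
    from order_continuousD[OF T A this]
    obtain B :: "'b set" and leB y where y: "decreases_to_zero B leB y"
      and dom: "dominates_tails B y A le (\<lambda>p. T (snd p)) 0"
      unfolding order_converges_def by blast
    have "\<exists>w\<in>W. \<forall>x. \<bar>x\<bar> \<le> w \<longrightarrow> \<bar>T x\<bar> \<le> v" if v: "v \<in> y ` B" for v
    proof -
      obtain j where "j \<in> B" "v = y j" using v by blast
      then obtain p where p: "p \<in> A" "\<forall>q\<in>A. le p q \<longrightarrow> \<bar>T (snd q) - 0\<bar> \<le> v"
        using dom unfolding dominates_tails_def by blast
      have "fst p \<in> W" using p(1) unfolding A_def by auto
      moreover have "\<bar>T x\<bar> \<le> v" if "\<bar>x\<bar> \<le> fst p" for x
        using p(2)[rule_format, of "(fst p, x)"] that \<open>fst p \<in> W\<close>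
        unfolding A_def le_def by simp
      ultimately show ?thesis by blast
    qed
    with null_base_image[OF y]
    show "\<exists>V. null_base V \<and> (\<forall>v\<in>V. \<exists>w\<in>W. \<forall>x. \<bar>x\<bar> \<le> w \<longrightarrow> \<bar>T x\<bar> \<le> v)"
      by blast
  qed
next
  assume R: ?R
  show "order_continuous T"
    unfolding order_continuous_def
  proof (intro allI impI)
    fix A :: "('a \<times> 'a set) set" and le and x :: "'a \<times> 'a set \<Rightarrow> 'a"
    assume "order_converges A le x 0"
    then obtain B :: "'a set" and leB y where y: "decreases_to_zero B leB y"
      and dom: "dominates_tails B y A le x 0"
      unfolding order_converges_def by blast
    obtain V where V: "null_base V"
      and bound: "\<forall>v\<in>V. \<exists>w\<in>y ` B. \<forall>x. \<bar>x\<bar> \<le> w \<longrightarrow> \<bar>T x\<bar> \<le> v"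
      using R null_base_image[OF y] by blast
    have "dominates_tails V (\<lambda>v. v) A le (\<lambda>\<alpha>. T (x \<alpha>)) 0"
      unfolding dominates_tails_def
    proof
      fix v assume "v \<in> V"
      then obtain j where j: "j \<in> B" "\<forall>x. \<bar>x\<bar> \<le> y j \<longrightarrow> \<bar>T x\<bar> \<le> v"
        using bound by blast
      then obtain i where "i \<in> A" "\<forall>k\<in>A. le i k \<longrightarrow> \<bar>x k - 0\<bar> \<le> y j"
        using dom unfolding dominates_tails_def by blast
      with j(2) show "\<exists>i\<in>A. \<forall>k\<in>A. le i k \<longrightarrow> \<bar>T (x k) - 0\<bar> \<le> v"
        by auto
    qed
    then show "order_converges A le (\<lambda>\<alpha>. T (x \<alpha>)) 0"
      by (rule order_convergesI[OF null_base_decreases_to_zero[OF V]])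
  qed
qed

lemma order_continuous_boundE:
  assumes "order_continuous T" "null_base W"
  obtains V where "null_base V" "\<forall>v\<in>V. \<exists>w\<in>W. \<forall>x. \<bar>x\<bar> \<le> w \<longrightarrow> \<bar>T x\<bar> \<le> v"
  using assms unfolding order_continuous_iff by blast

lemma order_continuousI:
  assumes "\<And>W. null_base W \<Longrightarrow>
    \<exists>V. null_base V \<and> (\<forall>v\<in>V. \<exists>w\<in>W. \<forall>x. \<bar>x\<bar> \<le> w \<longrightarrow> \<bar>T x\<bar> \<le> v)"
  shows "order_continuous T"
  using assms unfolding order_continuous_iff by blast

lemma order_continuous_id: "order_continuous id"
  by (rule order_continuousI) auto

lemma order_continuous_compose:
  fixes T :: "'a::vector_lattice \<Rightarrow> 'b::vector_lattice" and S :: "'b \<Rightarrow> 'c::vector_lattice"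
  assumes S: "order_continuous S" and T: "order_continuous T"
  shows "order_continuous (S \<circ> T)"
proof (rule order_continuousI)
  fix W :: "'a set" assume W: "null_base W"
  obtain V where V: "null_base V" "\<forall>v\<in>V. \<exists>w\<in>W. \<forall>x. \<bar>x\<bar> \<le> w \<longrightarrow> \<bar>T x\<bar> \<le> v"
    by (rule order_continuous_boundE[OF T W])
  obtain U where U: "null_base U" "\<forall>u\<in>U. \<exists>v\<in>V. \<forall>x. \<bar>x\<bar> \<le> v \<longrightarrow> \<bar>S x\<bar> \<le> u"
    by (rule order_continuous_boundE[OF S V(1)])
  have "\<exists>w\<in>W. \<forall>x. \<bar>x\<bar> \<le> w \<longrightarrow> \<bar>(S \<circ> T) x\<bar> \<le> u" if "u \<in> U" for u
  proof -
    obtain v where v: "v \<in> V" "\<forall>x. \<bar>x\<bar> \<le> v \<longrightarrow> \<bar>S x\<bar> \<le> u"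
      using U(2) \<open>u \<in> U\<close> by blast
    then obtain w where "w \<in> W" "\<forall>x. \<bar>x\<bar> \<le> w \<longrightarrow> \<bar>T x\<bar> \<le> v"
      using V(2) by blast
    with v(2) show ?thesis by auto
  qed
  with U(1) show "\<exists>V. null_base V \<and> (\<forall>v\<in>V. \<exists>w\<in>W. \<forall>x. \<bar>x\<bar> \<le> w \<longrightarrow> \<bar>(S \<circ> T) x\<bar> \<le> v)"
    by blast
qed

section \<open>Approximation by brackets in the order completion\<close>

context
  fixes \<iota> :: "'a::archimedean_vector_lattice \<Rightarrow> 'b::dedekind_complete_vector_lattice"
  assumes completion: "order_completion \<iota>"
begin

lemma linear_embedding: "linear \<iota>"
  and embedding_sup: "\<iota> (sup x y) = sup (\<iota> x) (\<iota> y)"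
  and embedding_inf: "\<iota> (inf x y) = inf (\<iota> x) (\<iota> y)"
  and embedding_inj: "\<iota> x = \<iota> y \<longleftrightarrow> x = y"
  and embedding_dense: "0 < u \<Longrightarrow> \<exists>x>0. \<iota> x \<le> u"
  and embedding_majorizing: "\<exists>x. u \<le> \<iota> x"
  using completion unfolding order_completion_def inj_def by blast+

lemmas embedding_linear_simps =
  linear_add[OF linear_embedding] linear_diff[OF linear_embedding] linear_neg[OF linear_embedding]
  linear_0[OF linear_embedding] linear_scale[OF linear_embedding]

lemma embedding_le: "\<iota> x \<le> \<iota> y \<longleftrightarrow> x \<le> y"
  by (metis embedding_inf embedding_inj le_iff_inf)

lemma embedding_abs: "\<iota> \<bar>x\<bar> = \<bar>\<iota> x\<bar>"
  by (simp add: abs_lattice embedding_sup embedding_linear_simps)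

lemma embedding_minorizing: "\<exists>x. \<iota> x \<le> u"
proof -
  obtain x where "- u \<le> \<iota> x" using embedding_majorizing by blast
  then have "\<iota> (- x) \<le> u"
    by (simp add: embedding_linear_simps minus_le_iff)
  then show ?thesis by blast
qed

text \<open>
  This is where the Archimedean property enters. If \<open>z\<close> bounds all minorants of \<open>y\<close> from \<open>X\<close> but
  not \<open>y\<close>, some positive \<open>e\<close> in \<open>X\<close> fits below \<open>y - inf z y\<close>. Then adding \<open>e\<close> to a minorant gives
  another minorant, so all multiples of \<open>e\<close> stay bounded and \<open>e \<le> 0\<close>.
\<close>

lemma le_if_minorants_le:
  assumes minorants: "\<And>x. \<iota> x \<le> y \<Longrightarrow> \<iota> x \<le> z"
  shows "y \<le> z"
proof (rule ccontr)
  assume "\<not> y \<le> z"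
  then have "inf z y < y"
    by (metis inf.cobounded1 inf.cobounded2 order_le_imp_less_or_eq)
  then obtain e where e: "0 < e" "\<iota> e \<le> y - inf z y"
    using embedding_dense[of "y - inf z y"] by (metis diff_gt_0_iff_gt)
  obtain b where b: "\<iota> b \<le> y" using embedding_minorizing by blast
  obtain a where a: "y \<le> \<iota> a" using embedding_majorizing by blast
  have "\<iota> (b + real n *\<^sub>R e) \<le> y" for n :: nat
  proof (induction n)
    case 0
    show ?case using b by simp
  next
    case (Suc n)
    then have "\<iota> (b + real n *\<^sub>R e) \<le> inf z y"
      using minorants by simp
    then have "\<iota> (b + real n *\<^sub>R e) + \<iota> e \<le> y"
      using add_mono[OF _ e(2), of _ "inf z y"] by (simp only: add_diff_cancel_left' add_diff_eq)
    then show ?case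
      by (simp add: embedding_linear_simps algebra_simps)
  qed
  then have "\<iota> (b + real n *\<^sub>R e) \<le> \<iota> a" for n :: nat
    using a order_trans by blast
  then have "real n *\<^sub>R e \<le> a - b" for n :: nat
    unfolding embedding_le by (simp add: algebra_simps)
  then have "e \<le> 0" by (rule archimedean)
  with e(1) show False by simp
qed

lemma le_if_le_majorants:
  assumes majorants: "\<And>x. y \<le> \<iota> x \<Longrightarrow> z \<le> \<iota> x"
  shows "z \<le> y"
proof -
  have "- y \<le> - z"
  proof (rule le_if_minorants_le)
    fix x assume "\<iota> x \<le> - y"
    then have "z \<le> \<iota> (- x)"
      by (intro majorants) (simp add: embedding_linear_simps le_minus_iff)
    then show "\<iota> x \<le> - z"
      by (simp add: embedding_linear_simps le_minus_iff)
  qed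
  then show ?thesis by simp
qed

lemma null_base_embedding:
  assumes W: "null_base W"
  shows "null_base (\<iota> ` W)"
proof (rule null_baseI)
  show "\<iota> ` W \<noteq> {}" using null_base_ne[OF W] by simp
next
  fix u v assume "u \<in> \<iota> ` W" "v \<in> \<iota> ` W"
  then show "\<exists>w\<in>\<iota> ` W. w \<le> u \<and> w \<le> v"
    using null_base_directed[OF W] by (auto simp: embedding_le)
next
  fix w assume "w \<in> \<iota> ` W"
  then show "0 \<le> w"
    using null_base_nonneg[OF W] embedding_le[of 0] by (auto simp: embedding_linear_simps)
next
  fix z assume z: "\<And>w. w \<in> \<iota> ` W \<Longrightarrow> z \<le> w"
  show "z \<le> 0"
  proof (rule le_if_minorants_le)
    fix x assume "\<iota> x \<le> z"
    then have "x \<le> w" if "w \<in> W" for w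
      using z[of "\<iota> w"] that by (metis embedding_le image_eqI order_trans)
    then have "x \<le> 0" by (rule null_base_le_0[OF W])
    then show "\<iota> x \<le> 0"
      using embedding_le[of x 0] by (simp add: embedding_linear_simps)
  qed
qed

text \<open>
  A net decreasing to \<open>0\<close> in \<open>X\<^sup>\<delta>\<close> is dominated by one in \<open>X\<close>, because \<open>w\<close> is the infimum of its
  majorants from \<open>X\<close>. This brings the order continuity of operators on \<open>X\<close> to bear on \<open>X\<^sup>\<delta>\<close>.
\<close>

lemma null_base_majorants:
  assumes W: "null_base W"
  shows "null_base {x. \<exists>w\<in>W. w \<le> \<iota> x}"
proof (rule null_baseI)
  show "{x. \<exists>w\<in>W. w \<le> \<iota> x} \<noteq> {}"
    using null_base_ne[OF W] embedding_majorizing by blast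
next
  fix x x' assume "x \<in> {x. \<exists>w\<in>W. w \<le> \<iota> x}" "x' \<in> {x. \<exists>w\<in>W. w \<le> \<iota> x}"
  then obtain w w' where w: "w \<in> W" "w' \<in> W" "w \<le> \<iota> x" "w' \<le> \<iota> x'" by blast
  then obtain w'' where "w'' \<in> W" "w'' \<le> w" "w'' \<le> w'"
    using null_base_directed[OF W] by blast
  with w have "w'' \<le> \<iota> (inf x x')"
    by (auto simp: embedding_inf)
  with \<open>w'' \<in> W\<close> show "\<exists>u\<in>{x. \<exists>w\<in>W. w \<le> \<iota> x}. u \<le> x \<and> u \<le> x'"
    by (intro bexI[of _ "inf x x'"]) auto
next
  fix x assume "x \<in> {x. \<exists>w\<in>W. w \<le> \<iota> x}"
  then have "\<iota> 0 \<le> \<iota> x"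
    using null_base_nonneg[OF W] by (auto simp: embedding_linear_simps intro: order_trans)
  then show "0 \<le> x" by (simp only: embedding_le)
next
  fix z assume z: "\<And>x. x \<in> {x. \<exists>w\<in>W. w \<le> \<iota> x} \<Longrightarrow> z \<le> x"
  have "\<iota> z \<le> w" if "w \<in> W" for w
  proof (rule le_if_le_majorants)
    fix x assume "w \<le> \<iota> x"
    then have "z \<le> x" using z that by blast
    then show "\<iota> z \<le> \<iota> x" by (simp only: embedding_le)
  qed
  then have "\<iota> z \<le> \<iota> 0"
    unfolding linear_0[OF linear_embedding] by (rule null_base_le_0[OF W])
  then show "z \<le> 0" by (simp only: embedding_le)
qed

lemma order_continuous_embedding: "order_continuous \<iota>"
proof (rule order_continuousI)
  fix W :: "'a set" assume "null_base W"
  moreover have "\<forall>v\<in>\<iota> ` W. \<exists>w\<in>W. \<forall>x. \<bar>x\<bar> \<le> w \<longrightarrow> \<bar>\<iota> x\<bar> \<le> v"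
    by (auto simp: embedding_le simp flip: embedding_abs)
  ultimately show "\<exists>V. null_base V \<and> (\<forall>v\<in>V. \<exists>w\<in>W. \<forall>x. \<bar>x\<bar> \<le> w \<longrightarrow> \<bar>\<iota> x\<bar> \<le> v)"
    using null_base_embedding by blast
qed

definition bracket :: "'b \<Rightarrow> 'a \<Rightarrow> 'a \<Rightarrow> bool" where
  "bracket y b a \<longleftrightarrow> \<iota> b \<le> y \<and> y \<le> \<iota> a"

lemma bracket_le: "bracket y b a \<Longrightarrow> b \<le> a"
  unfolding bracket_def using embedding_le order_trans by blast

lemma bracket_refine:
  "bracket y b a \<Longrightarrow> bracket y b' a' \<Longrightarrow> bracket y (sup b b') (inf a a')"
  unfolding bracket_def by (simp add: embedding_sup embedding_inf)

lemma brackets_meet: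
  assumes "bracket y b a" "bracket y b' a'"
  shows "\<exists>x. b \<le> x \<and> x \<le> a \<and> b' \<le> x \<and> x \<le> a'"
  using bracket_le[OF bracket_refine[OF assms]]
  by (intro exI[of _ "sup b b'"]) auto

lemma null_base_bracket_widths: "null_base {a - b | a b. bracket y b a}"
proof (rule null_baseI)
  show "{a - b | a b. bracket y b a} \<noteq> {}"
    using embedding_majorizing[of y] embedding_minorizing[of y] unfolding bracket_def by blast
next
  fix p q assume "p \<in> {a - b | a b. bracket y b a}" "q \<in> {a - b | a b. bracket y b a}"
  then obtain a b a' b' where "p = a - b" "q = a' - b'" "bracket y b a" "bracket y b' a'"
    by blast
  moreover from this have "inf a a' - sup b b' \<in> {a - b | a b. bracket y b a}"
    using bracket_refine by blast
  moreover have "inf a a' - sup b b' \<le> a - b" "inf a a' - sup b b' \<le> a' - b'"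
    by (rule diff_mono; simp)+
  ultimately show "\<exists>r\<in>{a - b | a b. bracket y b a}. r \<le> p \<and> r \<le> q"
    by blast
next
  fix p assume "p \<in> {a - b | a b. bracket y b a}"
  then show "0 \<le> p" using bracket_le by auto
next
  fix z assume z: "\<And>p. p \<in> {a - b | a b. bracket y b a} \<Longrightarrow> z \<le> p"
  have "y \<le> y - \<iota> z"
  proof (rule le_if_minorants_le)
    fix b assume b: "\<iota> b \<le> y"
    have "\<iota> z + \<iota> b \<le> y"
    proof (rule le_if_le_majorants)
      fix a assume "y \<le> \<iota> a"
      then have "z \<le> a - b" using b z unfolding bracket_def by blast
      then have "z + b \<le> a" by (simp add: algebra_simps)
      then show "\<iota> z + \<iota> b \<le> \<iota> a"
        using embedding_le[of "z + b" a] by (simp add: embedding_linear_simps)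
    qed
    then show "\<iota> b \<le> y - \<iota> z" by (simp add: algebra_simps)
  qed
  then show "z \<le> 0"
    using embedding_le[of z 0] by (simp add: embedding_linear_simps)
qed

section \<open>Limits along shrinking brackets\<close>

text \<open>
  The net of all \<open>x \<in> X\<close> in brackets of \<open>y\<close> order converges to \<open>y\<close>; this predicate expresses that
  its image under \<open>R\<close> order converges to \<open>l\<close>. Every bracket contains elements of \<open>X\<close>, which is not
  true of arbitrarily small order intervals around \<open>y\<close>.
\<close>

definition bracket_limit :: "('a \<Rightarrow> 'c::vector_lattice) \<Rightarrow> 'b \<Rightarrow> 'c \<Rightarrow> bool" where
  "bracket_limit R y l \<longleftrightarrow>
     (\<exists>V. null_base V \<and>
       (\<forall>v\<in>V. \<exists>b a. bracket y b a \<and> (\<forall>x. b \<le> x \<longrightarrow> x \<le> a \<longrightarrow> \<bar>R x - l\<bar> \<le> v)))"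

lemma bracket_limitI:
  assumes "null_base V"
    "\<And>v. v \<in> V \<Longrightarrow> \<exists>b a. bracket y b a \<and> (\<forall>x. b \<le> x \<longrightarrow> x \<le> a \<longrightarrow> \<bar>R x - l\<bar> \<le> v)"
  shows "bracket_limit R y l"
  using assms unfolding bracket_limit_def by blast

lemma bracket_limitE:
  assumes "bracket_limit R y l"
  obtains V where "null_base V"
    "\<forall>v\<in>V. \<exists>b a. bracket y b a \<and> (\<forall>x. b \<le> x \<longrightarrow> x \<le> a \<longrightarrow> \<bar>R x - l\<bar> \<le> v)"
  using assms unfolding bracket_limit_def by blast

text \<open>
  A bound on one bracket passes to the limit because any two brackets of \<open>y\<close> have an element of
  \<open>X\<close> in common.
\<close>

lemma bracket_limit_dist_le:
  assumes l: "bracket_limit R y l" and ba: "bracket y b a"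
    and bound: "\<And>x. b \<le> x \<Longrightarrow> x \<le> a \<Longrightarrow> \<bar>R x - c\<bar> \<le> v"
  shows "\<bar>l - c\<bar> \<le> v"
proof -
  obtain V where V: "null_base V"
    "\<forall>u\<in>V. \<exists>b a. bracket y b a \<and> (\<forall>x. b \<le> x \<longrightarrow> x \<le> a \<longrightarrow> \<bar>R x - l\<bar> \<le> u)"
    by (rule bracket_limitE[OF l])
  show ?thesis
  proof (rule null_base_add_le[OF V(1)])
    fix u assume "u \<in> V"
    then obtain b' a' where b'a': "bracket y b' a'"
      "\<forall>x. b' \<le> x \<longrightarrow> x \<le> a' \<longrightarrow> \<bar>R x - l\<bar> \<le> u"
      using V(2) by blast
    obtain x where x: "b \<le> x" "x \<le> a" "b' \<le> x" "x \<le> a'"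
      using brackets_meet[OF ba b'a'(1)] by blast
    have "\<bar>l - c\<bar> = \<bar>(R x - c) - (R x - l)\<bar>" by simp
    also have "\<dots> \<le> \<bar>R x - c\<bar> + \<bar>R x - l\<bar>" by (rule abs_triangle_ineq4)
    also have "\<dots> \<le> v + u"
      using bound x b'a'(2) by (intro add_mono) auto
    finally show "\<bar>l - c\<bar> \<le> v + u" .
  qed
qed

lemma bracket_limit_unique:
  assumes l: "bracket_limit R y l" and l': "bracket_limit R y l'"
  shows "l = l'"
proof -
  obtain V where V: "null_base V"
    "\<forall>u\<in>V. \<exists>b a. bracket y b a \<and> (\<forall>x. b \<le> x \<longrightarrow> x \<le> a \<longrightarrow> \<bar>R x - l'\<bar> \<le> u)"
    by (rule bracket_limitE[OF l'])
  have "\<bar>l - l'\<bar> \<le> 0"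
  proof (rule null_base_le_0[OF V(1)])
    fix u assume "u \<in> V"
    then obtain b a where "bracket y b a" "\<forall>x. b \<le> x \<longrightarrow> x \<le> a \<longrightarrow> \<bar>R x - l'\<bar> \<le> u"
      using V(2) by blast
    then show "\<bar>l - l'\<bar> \<le> u"
      using bracket_limit_dist_le[OF l] by blast
  qed
  then show ?thesis by simp
qed

text \<open>
  Order continuity makes the oscillation of \<open>R\<close> on brackets of \<open>y\<close> small. So all the lower estimates
  \<open>R x - v\<close> for the limit lie below all the upper estimates \<open>R x' + v'\<close>, and the infimum of the latter
  lies between them.
\<close>

lemma bracket_limit_exists:
  fixes R :: "'a \<Rightarrow> 'c::dedekind_complete_vector_lattice"
  assumes lin: "linear R" and cont: "order_continuous R"
  shows "\<exists>l. bracket_limit R y l"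
proof -
  obtain V where V: "null_base V"
    "\<forall>v\<in>V. \<exists>w\<in>{a - b | a b. bracket y b a}. \<forall>x. \<bar>x\<bar> \<le> w \<longrightarrow> \<bar>R x\<bar> \<le> v"
    by (rule order_continuous_boundE[OF cont null_base_bracket_widths[of y]])
  define good where "good v b a \<longleftrightarrow> bracket y b a \<and>
    (\<forall>x x'. b \<le> x \<longrightarrow> x \<le> a \<longrightarrow> b \<le> x' \<longrightarrow> x' \<le> a \<longrightarrow> \<bar>R x - R x'\<bar> \<le> v)" for v b a
  have good: "\<exists>b a. good v b a" if v: "v \<in> V" for v
  proof -
    obtain a b where ba: "bracket y b a" "\<forall>x. \<bar>x\<bar> \<le> a - b \<longrightarrow> \<bar>R x\<bar> \<le> v"
      using V(2)[rule_format, OF v] by blast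
    have "\<bar>R x - R x'\<bar> \<le> v" if "b \<le> x" "x \<le> a" "b \<le> x'" "x' \<le> a" for x x'
    proof -
      have "x - x' \<le> a - b" "x' - x \<le> a - b"
        using that by (auto intro: diff_mono)
      then have "\<bar>x - x'\<bar> \<le> a - b" by (intro abs_leI) auto
      then show ?thesis using ba(2) by (simp flip: linear_diff[OF lin])
    qed
    with ba(1) show ?thesis unfolding good_def by blast
  qed
  define S where "S = {R x + v | x v. v \<in> V \<and> (\<exists>b a. good v b a \<and> b \<le> x \<and> x \<le> a)}"
  have lower: "R x - v \<le> s" if "good v b a" "b \<le> x" "x \<le> a" "s \<in> S" for v b a x s
  proof -
    obtain x' v' b' a' where s: "s = R x' + v'" "good v' b' a'" "b' \<le> x'" "x' \<le> a'"
      using \<open>s \<in> S\<close> unfolding S_def by blast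
    obtain t where t: "b \<le> t" "t \<le> a" "b' \<le> t" "t \<le> a'"
      using brackets_meet \<open>good v b a\<close> s(2) unfolding good_def by blast
    have "R x - R t \<le> v" "R t - R x' \<le> v'"
      using that s t unfolding good_def by (blast intro: order_trans[OF abs_ge_self])+
    from add_mono[OF this] show ?thesis
      unfolding s(1) by (simp add: algebra_simps)
  qed
  have "S \<noteq> {}"
  proof -
    obtain v b a where "v \<in> V" "good v b a"
      using null_base_ne[OF V(1)] good by blast
    moreover from this have "b \<le> a" using bracket_le unfolding good_def by blast
    ultimately show ?thesis unfolding S_def by blast
  qed
  have "bdd_below S"
  proof -
    obtain v b a where "v \<in> V" "good v b a"
      using null_base_ne[OF V(1)] good by blast
    moreover from this have "b \<le> a" using bracket_le unfolding good_def by blast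
    ultimately show ?thesis
      using lower by (intro bdd_belowI[of _ "R b - v"]) blast
  qed
  have "bracket_limit R y (Inf S)"
  proof (rule bracket_limitI[OF V(1)])
    fix v assume "v \<in> V"
    then obtain b a where ba: "good v b a" using good by blast
    have "\<bar>R x - Inf S\<bar> \<le> v" if "b \<le> x" "x \<le> a" for x
    proof -
      have "R x - v \<le> Inf S"
        using \<open>S \<noteq> {}\<close> lower[OF ba that] by (rule cInf_greatest)
      moreover have "R x + v \<in> S"
        using \<open>v \<in> V\<close> ba that unfolding S_def by blast
      then have "Inf S \<le> R x + v"
        using \<open>bdd_below S\<close> by (rule cInf_lower)
      ultimately show ?thesis
        by (intro abs_leI) (simp_all add: algebra_simps)
    qed
    with ba show "\<exists>b a. bracket y b a \<and> (\<forall>x. b \<le> x \<longrightarrow> x \<le> a \<longrightarrow> \<bar>R x - Inf S\<bar> \<le> v)"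
      unfolding good_def by blast
  qed
  then show ?thesis by blast
qed

lemma bracket_limit_embedding: "bracket_limit R (\<iota> x) (R x)"
proof (rule bracket_limitI[OF null_base_singleton_0])
  fix v :: 'c assume "v \<in> {0}"
  moreover have "bracket (\<iota> x) x x" unfolding bracket_def by simp
  ultimately show
    "\<exists>b a. bracket (\<iota> x) b a \<and> (\<forall>x'. b \<le> x' \<longrightarrow> x' \<le> a \<longrightarrow> \<bar>R x' - R x\<bar> \<le> v)"
    by (metis abs_zero diff_self order_antisym order_refl singletonD)
qed

lemma bracket_limit_add:
  assumes lin: "linear R"
    and l: "bracket_limit R y l" and l': "bracket_limit R y' l'"
  shows "bracket_limit R (y + y') (l + l')"
proof -
  obtain V where V: "null_base V"
    "\<forall>v\<in>V. \<exists>b a. bracket y b a \<and> (\<forall>x. b \<le> x \<longrightarrow> x \<le> a \<longrightarrow> \<bar>R x - l\<bar> \<le> v)"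
    by (rule bracket_limitE[OF l])
  obtain V' where V': "null_base V'"
    "\<forall>v\<in>V'. \<exists>b a. bracket y' b a \<and> (\<forall>x. b \<le> x \<longrightarrow> x \<le> a \<longrightarrow> \<bar>R x - l'\<bar> \<le> v)"
    by (rule bracket_limitE[OF l'])
  show ?thesis
  proof (rule bracket_limitI[OF null_base_plus[OF V(1) V'(1)]])
    fix u assume "u \<in> {v + w | v w. v \<in> V \<and> w \<in> V'}"
    then obtain v v' where u: "u = v + v'" "v \<in> V" "v' \<in> V'" by blast
    obtain b a where ba: "bracket y b a" "\<forall>x. b \<le> x \<longrightarrow> x \<le> a \<longrightarrow> \<bar>R x - l\<bar> \<le> v"
      using V(2) u by blast
    obtain b' a' where ba': "bracket y' b' a'" "\<forall>x. b' \<le> x \<longrightarrow> x \<le> a' \<longrightarrow> \<bar>R x - l'\<bar> \<le> v'"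
      using V'(2) u by blast
    have "bracket (y + y') (b + b') (a + a')"
      using ba ba' unfolding bracket_def by (auto simp: embedding_linear_simps intro: add_mono)
    moreover have "\<bar>R x - (l + l')\<bar> \<le> u" if x: "b + b' \<le> x" "x \<le> a + a'" for x
    proof -
      \<comment> \<open>Riesz decomposition: \<open>x\<close> is the sum of \<open>p \<in> [b, a]\<close> and \<open>x - p \<in> [b', a']\<close>.\<close>
      define p where "p = inf a (x - b')"
      have p: "b \<le> p" "p \<le> a"
        using x bracket_le[OF ba(1)] unfolding p_def by (auto simp: algebra_simps)
      have "p \<le> x - b'" unfolding p_def by simp
      then have "b' \<le> x - p" by (simp add: algebra_simps)
      moreover have "x - a' \<le> p"
        using x bracket_le[OF ba'(1)] unfolding p_def by (auto simp: algebra_simps)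
      then have "x - p \<le> a'" by (simp add: algebra_simps)
      ultimately have "\<bar>R p - l\<bar> + \<bar>R (x - p) - l'\<bar> \<le> v + v'"
        using ba(2) ba'(2) p by (intro add_mono) auto
      moreover have "\<bar>R x - (l + l')\<bar> \<le> \<bar>R p - l\<bar> + \<bar>R (x - p) - l'\<bar>"
        using abs_triangle_ineq[of "R p - l" "R (x - p) - l'"]
        by (simp add: linear_diff[OF lin] algebra_simps)
      ultimately show ?thesis unfolding u(1) by (rule order_trans[rotated])
    qed
    ultimately show "\<exists>b a. bracket (y + y') b a \<and>
        (\<forall>x. b \<le> x \<longrightarrow> x \<le> a \<longrightarrow> \<bar>R x - (l + l')\<bar> \<le> u)"
      by blast
  qed
qed

lemma bracket_limit_minus:
  assumes lin: "linear R" and l: "bracket_limit R y l"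
  shows "bracket_limit R (- y) (- l)"
proof -
  obtain V where V: "null_base V"
    "\<forall>v\<in>V. \<exists>b a. bracket y b a \<and> (\<forall>x. b \<le> x \<longrightarrow> x \<le> a \<longrightarrow> \<bar>R x - l\<bar> \<le> v)"
    by (rule bracket_limitE[OF l])
  show ?thesis
  proof (rule bracket_limitI[OF V(1)])
    fix v assume "v \<in> V"
    then obtain b a where ba: "bracket y b a" "\<forall>x. b \<le> x \<longrightarrow> x \<le> a \<longrightarrow> \<bar>R x - l\<bar> \<le> v"
      using V(2) by blast
    have "bracket (- y) (- a) (- b)"
      using ba(1) unfolding bracket_def by (simp add: embedding_linear_simps)
    moreover have "\<bar>R x - (- l)\<bar> \<le> v" if "- a \<le> x" "x \<le> - b" for x
    proof -
      have "b \<le> - x" "- x \<le> a" using that by (auto simp: le_minus_iff minus_le_iff)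
      then have "\<bar>R (- x) - l\<bar> \<le> v" using ba(2) by blast
      moreover have "R (- x) - l = - (R x - (- l))" by (simp add: linear_neg[OF lin])
      ultimately show ?thesis by (simp only: abs_minus_cancel)
    qed
    ultimately show
      "\<exists>b a. bracket (- y) b a \<and> (\<forall>x. b \<le> x \<longrightarrow> x \<le> a \<longrightarrow> \<bar>R x - (- l)\<bar> \<le> v)"
      by blast
  qed
qed

lemma bracket_limit_scaleR_pos:
  assumes lin: "linear R" and l: "bracket_limit R y l" and c: "0 < c"
  shows "bracket_limit R (c *\<^sub>R y) (c *\<^sub>R l)"
proof -
  obtain V where V: "null_base V"
    "\<forall>v\<in>V. \<exists>b a. bracket y b a \<and> (\<forall>x. b \<le> x \<longrightarrow> x \<le> a \<longrightarrow> \<bar>R x - l\<bar> \<le> v)"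
    by (rule bracket_limitE[OF l])
  show ?thesis
  proof (rule bracket_limitI[OF null_base_scaleR[OF V(1) c]])
    fix u assume "u \<in> (*\<^sub>R) c ` V"
    then obtain v where u: "u = c *\<^sub>R v" "v \<in> V" by blast
    then obtain b a where ba: "bracket y b a" "\<forall>x. b \<le> x \<longrightarrow> x \<le> a \<longrightarrow> \<bar>R x - l\<bar> \<le> v"
      using V(2) by blast
    have "bracket (c *\<^sub>R y) (c *\<^sub>R b) (c *\<^sub>R a)"
      using ba(1) c unfolding bracket_def
      by (auto simp: embedding_linear_simps intro: scaleR_left_mono)
    moreover have "\<bar>R x - c *\<^sub>R l\<bar> \<le> u" if x: "c *\<^sub>R b \<le> x" "x \<le> c *\<^sub>R a" for x
    proof -
      have "b \<le> inverse c *\<^sub>R x" "inverse c *\<^sub>R x \<le> a"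
        using scaleR_left_mono[OF x(1), of "inverse c"] scaleR_left_mono[OF x(2), of "inverse c"] c
        by simp_all
      then have "\<bar>R (inverse c *\<^sub>R x) - l\<bar> \<le> v" using ba(2) by blast
      then have "c *\<^sub>R \<bar>R (inverse c *\<^sub>R x) - l\<bar> \<le> u"
        unfolding u(1) using c by (intro scaleR_left_mono) auto
      moreover have "R x - c *\<^sub>R l = c *\<^sub>R (R (inverse c *\<^sub>R x) - l)"
        using c by (simp add: linear_scale[OF lin] scaleR_right_diff_distrib)
      ultimately show ?thesis
        using abs_scaleR_pos[OF c] by (metis order_trans)
    qed
    ultimately show "\<exists>b a. bracket (c *\<^sub>R y) b a \<and>
        (\<forall>x. b \<le> x \<longrightarrow> x \<le> a \<longrightarrow> \<bar>R x - c *\<^sub>R l\<bar> \<le> u)"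
      by blast
  qed
qed

lemma bracket_limit_scaleR:
  assumes lin: "linear R" and l: "bracket_limit R y l"
  shows "bracket_limit R (c *\<^sub>R y) (c *\<^sub>R l)"
proof (cases c "0 :: real" rule: linorder_cases)
  case less
  then have "bracket_limit R (- ((- c) *\<^sub>R y)) (- ((- c) *\<^sub>R l))"
    by (intro bracket_limit_minus bracket_limit_scaleR_pos lin l) simp
  then show ?thesis by simp
next
  case equal
  then show ?thesis
    using bracket_limit_embedding[of R 0] by (simp add: embedding_linear_simps linear_0[OF lin])
next
  case greater
  then show ?thesis by (rule bracket_limit_scaleR_pos[OF lin l])
qed

section \<open>Extension of order continuous operators\<close>

text \<open>
  For \<open>x\<close> in a bracket \<open>b \<le> y \<le> a\<close> the distance of \<open>x\<close> from \<open>y\<close> is at most \<open>a - b\<close>, on which scale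
  an order continuous operator \<open>S\<close> is uniformly small. Hence \<open>S y\<close> is determined by the values of
  \<open>S\<close> on \<open>X\<close>.
\<close>

lemma bracket_limit_extension:
  assumes lin: "linear S" and cont: "order_continuous S" and ext: "\<And>x. S (\<iota> x) = R x"
  shows "bracket_limit R y (S y)"
proof -
  obtain V where V: "null_base V"
    "\<forall>v\<in>V. \<exists>w\<in>\<iota> ` {a - b | a b. bracket y b a}. \<forall>z. \<bar>z\<bar> \<le> w \<longrightarrow> \<bar>S z\<bar> \<le> v"
    by (rule order_continuous_boundE[OF cont null_base_embedding[OF null_base_bracket_widths[of y]]])
  show ?thesis
  proof (rule bracket_limitI[OF V(1)])
    fix v assume "v \<in> V"
    then obtain a b where ba: "bracket y b a" "\<forall>z. \<bar>z\<bar> \<le> \<iota> (a - b) \<longrightarrow> \<bar>S z\<bar> \<le> v"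
      using V(2) by blast
    have "\<bar>R x - S y\<bar> \<le> v" if "b \<le> x" "x \<le> a" for x
    proof -
      have "\<iota> b \<le> \<iota> x" "\<iota> x \<le> \<iota> a" using that by (simp_all add: embedding_le)
      with ba(1) have "\<iota> x - y \<le> \<iota> a - \<iota> b" "y - \<iota> x \<le> \<iota> a - \<iota> b"
        unfolding bracket_def by (auto intro: diff_mono)
      then have "\<bar>\<iota> x - y\<bar> \<le> \<iota> (a - b)"
        by (intro abs_leI) (auto simp: embedding_linear_simps)
      then show ?thesis
        using ba(2) by (simp flip: ext linear_diff[OF lin])
    qed
    with ba(1) show "\<exists>b a. bracket y b a \<and> (\<forall>x. b \<le> x \<longrightarrow> x \<le> a \<longrightarrow> \<bar>R x - S y\<bar> \<le> v)"
      by blast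
  qed
qed

lemma order_continuous_extension_unique:
  fixes S S' :: "'b \<Rightarrow> 'c::vector_lattice"
  assumes "linear S" "order_continuous S" "linear S'" "order_continuous S'"
    and "\<And>x. S (\<iota> x) = S' (\<iota> x)"
  shows "S = S'"
proof
  fix y
  show "S y = S' y"
    by (rule bracket_limit_unique[where R = "\<lambda>x. S' (\<iota> x)" and y = y])
      (use assms in \<open>auto intro: bracket_limit_extension\<close>)
qed

lemma order_continuous_extension_exists:
  fixes R :: "'a \<Rightarrow> 'c::dedekind_complete_vector_lattice"
  assumes lin: "linear R" and cont: "order_continuous R"
  shows "\<exists>S. linear S \<and> order_continuous S \<and> (\<forall>x. S (\<iota> x) = R x)"
proof -
  obtain S where S: "\<And>y. bracket_limit R y (S y)"
    using bracket_limit_exists[OF lin cont] by metis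
  have ext: "S (\<iota> x) = R x" for x
    using S bracket_limit_embedding by (rule bracket_limit_unique)
  have "linear S"
  proof (rule linearI)
    show "S (y + z) = S y + S z" for y z
      using S bracket_limit_add[OF lin S S] by (rule bracket_limit_unique)
    show "S (c *\<^sub>R y) = c *\<^sub>R S y" for c y
      using S bracket_limit_scaleR[OF lin S] by (rule bracket_limit_unique)
  qed
  moreover have "order_continuous S"
  proof (rule order_continuousI)
    fix W :: "'b set" assume "null_base W"
    \<comment> \<open>Bounds from \<open>X\<close> are needed, so that \<open>\<bar>y\<bar> \<le> \<iota> w\<close> makes \<open>[- w, w]\<close> a bracket of \<open>y\<close>.\<close>
    then obtain V where V: "null_base V"
      "\<forall>v\<in>V. \<exists>w\<in>{x. \<exists>w\<in>W. w \<le> \<iota> x}. \<forall>x. \<bar>x\<bar> \<le> w \<longrightarrow> \<bar>R x\<bar> \<le> v"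
      using order_continuous_boundE[OF cont null_base_majorants] by blast
    have "\<exists>u\<in>W. \<forall>y. \<bar>y\<bar> \<le> u \<longrightarrow> \<bar>S y\<bar> \<le> v" if "v \<in> V" for v
    proof -
      obtain u w where u: "u \<in> W" "u \<le> \<iota> w" and w: "\<forall>x. \<bar>x\<bar> \<le> w \<longrightarrow> \<bar>R x\<bar> \<le> v"
        using V(2)[rule_format, OF \<open>v \<in> V\<close>] by blast
      have "\<bar>S y\<bar> \<le> v" if "\<bar>y\<bar> \<le> u" for y
      proof -
        have "\<bar>y\<bar> \<le> \<iota> w" using that u(2) by (rule order_trans)
        then have "y \<le> \<iota> w" "- y \<le> \<iota> w" by (simp_all add: abs_le_iff)
        then have "bracket y (- w) w"
          unfolding bracket_def by (simp add: embedding_linear_simps minus_le_iff)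
        moreover have "\<bar>R x - 0\<bar> \<le> v" if "- w \<le> x" "x \<le> w" for x
          using w that by (simp add: abs_le_iff minus_le_iff)
        ultimately have "\<bar>S y - 0\<bar> \<le> v"
          by (rule bracket_limit_dist_le[OF S])
        then show ?thesis by simp
      qed
      with u(1) show ?thesis by blast
    qed
    with V(1) show "\<exists>V. null_base V \<and> (\<forall>v\<in>V. \<exists>w\<in>W. \<forall>y. \<bar>y\<bar> \<le> w \<longrightarrow> \<bar>S y\<bar> \<le> v)"
      by blast
  qed
  ultimately show ?thesis using ext by blast
qed

end

section \<open>Extension of semigroups\<close>

theorem theorem1:
  fixes \<iota> :: "'a::archimedean_vector_lattice \<Rightarrow> 'b::dedekind_complete_vector_lattice"
    and T :: "real \<Rightarrow> 'a \<Rightarrow> 'a"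
  assumes "order_completion \<iota>"
    and "operator_semigroup T"
    and "\<And>s. s \<ge> 0 \<Longrightarrow> order_continuous (T s)"
  shows "\<exists>!T\<delta> :: real \<Rightarrow> 'b \<Rightarrow> 'b.
           T\<delta> \<in> extensional {0..} \<and>
           operator_semigroup T\<delta> \<and>
           (\<forall>s\<ge>0. order_continuous (T\<delta> s)) \<and>
           (\<forall>s\<ge>0. \<forall>x. T\<delta> s (\<iota> x) = \<iota> (T s x))"
proof -
  note unique = order_continuous_extension_unique[OF assms(1)]
  have T_lin: "linear (T s)" if "s \<ge> 0" for s
    using assms(2) that unfolding operator_semigroup_def by blast
  have T_add: "T (s + t) x = T s (T t x)" if "s \<ge> 0" "t \<ge> 0" for s t x
    using assms(2) that unfolding operator_semigroup_def by simp
  have T_0: "T 0 x = x" for x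
    using assms(2) unfolding operator_semigroup_def by simp
  have "\<exists>S. linear S \<and> order_continuous S \<and> (\<forall>x. S (\<iota> x) = \<iota> (T s x))" if "s \<ge> 0" for s
    using order_continuous_extension_exists[OF assms(1), of "\<iota> \<circ> T s"]
      linear_compose[OF T_lin[OF that] linear_embedding[OF assms(1)]]
      order_continuous_compose[OF order_continuous_embedding[OF assms(1)] assms(3)[OF that]]
    by simp
  then obtain E where E: "\<And>s. s \<ge> 0 \<Longrightarrow> linear (E s)"
    "\<And>s. s \<ge> 0 \<Longrightarrow> order_continuous (E s)" "\<And>s x. s \<ge> 0 \<Longrightarrow> E s (\<iota> x) = \<iota> (T s x)"
    by metis
  define U where "U = restrict E {0..}"
  have U: "U s = E s" if "s \<ge> 0" for s using that unfolding U_def by simp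
  have "E (s + t) = E s \<circ> E t" if "s \<ge> 0" "t \<ge> 0" for s t
    using that by (intro unique)
      (auto simp: E T_add intro!: linear_compose order_continuous_compose E)
  moreover have "E 0 = id"
    by (intro unique) (auto simp: E T_0 order_continuous_id linear_id)
  ultimately have "operator_semigroup U"
    unfolding operator_semigroup_def using E(1) by (simp add: U)
  moreover have "U \<in> extensional {0..}" unfolding U_def by simp
  moreover have "S = U" if S: "S \<in> extensional {0..}" "operator_semigroup S"
    "\<forall>s\<ge>0. order_continuous (S s)" "\<forall>s\<ge>0. \<forall>x. S s (\<iota> x) = \<iota> (T s x)" for S
  proof (rule extensionalityI[OF S(1) \<open>U \<in> extensional {0..}\<close>])
    fix s :: real assume "s \<in> {0..}"
    then have "s \<ge> 0" by simp
    then show "S s = U s"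
      unfolding U[OF \<open>s \<ge> 0\<close>] using S E
      by (intro unique) (auto simp: operator_semigroup_def)
  qed
  moreover have "\<forall>s\<ge>0. order_continuous (U s)" "\<forall>s\<ge>0. \<forall>x. U s (\<iota> x) = \<iota> (T s x)"
    using E by (simp_all add: U)
  ultimately show ?thesis
    by (intro ex1I[of _ U]) blast+
qed

end
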